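(* Let $M$ be an abelian group (regarded as a $\mathbb{Z}$-module). The following statements are equivalent. (1) $M$ is simple-direct-injective. (2) $T(M)$ is simple-direct-injective. (3) $T_p(M)$ is simple-direct-injective for each prime $p$. (4) For each prime $p$, $T_p(M)$ is semisimple or $\mathrm{soc}(T_p(M))\subseteq \mathrm{rad}(T_p(M))$.
   Context: A module $M$ is simple-direct-injective if, whenever $A$ and $B$ are simple submodules of $M$ with $A\cong B$ and $B$ a direct summand of $M$, then $A$ is a direct summand of $M$. For an abelian group $M$, $T(M)$ is its torsion subgroup and, for a prime $p$, $T_p(M)=\{m\in T(M): p^n m=0 \text{ for some } n\ge 1\}$ is its $p$-primary component. $\mathrm{soc}(X)$ is the sum of all simple submodules of $X$; $\mathrm{rad}(X)$ is the intersection of all maximal submodules of $X$, with $\mathrm{rad}(X)=X$ if $X$ has no maximal submodules. *)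

theory Defs
  imports "HOL-Algebra.Module" "HOL-Algebra.AbelCoset" "HOL-Algebra.IntRing"
begin

section \<open>Submodule notions over a commutative ring\<close>

text \<open>
  A submodule is a carrier set \<open>N\<close> with \<open>submodule N R M\<close>; regarded as a module in its own
  right it is \<open>M\<lparr>carrier := N\<rparr>\<close>.
\<close>

definition module_iso ::
  "('r, 'x) ring_scheme \<Rightarrow> ('r, 'a, 'y) module_scheme \<Rightarrow> ('r, 'b, 'z) module_scheme \<Rightarrow> ('a \<Rightarrow> 'b) set"
  where "module_iso R M N =
    {f. bij_betw f (carrier M) (carrier N) \<and>
        (\<forall>x \<in> carrier M. \<forall>y \<in> carrier M. f (x \<oplus>\<^bsub>M\<^esub> y) = f x \<oplus>\<^bsub>N\<^esub> f y) \<and>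
        (\<forall>r \<in> carrier R. \<forall>x \<in> carrier M. f (r \<odot>\<^bsub>M\<^esub> x) = r \<odot>\<^bsub>N\<^esub> f x)}"

definition simple_module :: "('r, 'x) ring_scheme \<Rightarrow> ('r, 'a, 'y) module_scheme \<Rightarrow> bool"
  where "simple_module R M \<longleftrightarrow>
    module R M \<and> carrier M \<noteq> {\<zero>\<^bsub>M\<^esub>} \<and>
    (\<forall>N. submodule N R M \<longrightarrow> N = {\<zero>\<^bsub>M\<^esub>} \<or> N = carrier M)"

definition simple_submodule ::
  "'a set \<Rightarrow> ('r, 'x) ring_scheme \<Rightarrow> ('r, 'a, 'y) module_scheme \<Rightarrow> bool"
  where "simple_submodule A R M \<longleftrightarrow>
    submodule A R M \<and> simple_module R (M\<lparr>carrier := A\<rparr>)"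

definition maximal_submodule ::
  "'a set \<Rightarrow> ('r, 'x) ring_scheme \<Rightarrow> ('r, 'a, 'y) module_scheme \<Rightarrow> bool"
  where "maximal_submodule N R M \<longleftrightarrow>
    submodule N R M \<and> N \<noteq> carrier M \<and>
    (\<forall>L. submodule L R M \<longrightarrow> N \<subseteq> L \<longrightarrow> L = N \<or> L = carrier M)"

definition direct_summand ::
  "'a set \<Rightarrow> ('r, 'x) ring_scheme \<Rightarrow> ('r, 'a, 'y) module_scheme \<Rightarrow> bool"
  where "direct_summand A R M \<longleftrightarrow>
    submodule A R M \<and>
    (\<exists>C. submodule C R M \<and> A \<inter> C = {\<zero>\<^bsub>M\<^esub>} \<and> A <+>\<^bsub>M\<^esub> C = carrier M)"

definition simple_direct_injective ::
  "('r, 'x) ring_scheme \<Rightarrow> ('r, 'a, 'y) module_scheme \<Rightarrow> bool"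
  where "simple_direct_injective R M \<longleftrightarrow>
    (\<forall>A B. simple_submodule A R M \<longrightarrow> simple_submodule B R M \<longrightarrow>
       module_iso R (M\<lparr>carrier := A\<rparr>) (M\<lparr>carrier := B\<rparr>) \<noteq> {} \<longrightarrow>
       direct_summand B R M \<longrightarrow> direct_summand A R M)"

text \<open>
  The sum of a family of submodules is the smallest submodule containing all of them; the sum
  of the empty family is the zero submodule.
\<close>

definition sum_of_submodules ::
  "('r, 'x) ring_scheme \<Rightarrow> ('r, 'a, 'y) module_scheme \<Rightarrow> 'a set set \<Rightarrow> 'a set"
  where "sum_of_submodules R M F = \<Inter> {N. submodule N R M \<and> \<Union> F \<subseteq> N}"

definition soc :: "('r, 'x) ring_scheme \<Rightarrow> ('r, 'a, 'y) module_scheme \<Rightarrow> 'a set"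
  where "soc R M = sum_of_submodules R M {A. simple_submodule A R M}"

text \<open>Intersecting with the carrier gives the whole module if there is no maximal submodule.\<close>

definition rad :: "('r, 'x) ring_scheme \<Rightarrow> ('r, 'a, 'y) module_scheme \<Rightarrow> 'a set"
  where "rad R M = carrier M \<inter> \<Inter> {N. maximal_submodule N R M}"

definition semisimple :: "('r, 'x) ring_scheme \<Rightarrow> ('r, 'a, 'y) module_scheme \<Rightarrow> bool"
  where "semisimple R M \<longleftrightarrow> soc R M = carrier M"

section \<open>Abelian groups as modules over the integers\<close>

text \<open>
  The locale \<open>abelian_group\<close> constrains only the additive part of the ring record, so the
  multiplicative fields are irrelevant and merely copied.
\<close>

definition int_module :: "('a, 'b) ring_scheme \<Rightarrow> (int, 'a) module"
  where "int_module G =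
    \<lparr>carrier = carrier G, monoid.mult = monoid.mult G, one = one G, zero = zero G, add = add G,
     smult = (\<lambda>k x. [k] \<cdot>\<^bsub>G\<^esub> x)\<rparr>"

definition torsion :: "('a, 'b) ring_scheme \<Rightarrow> 'a set"
  where "torsion G = {x \<in> carrier G. \<exists>n::nat. n \<ge> 1 \<and> [n] \<cdot>\<^bsub>G\<^esub> x = \<zero>\<^bsub>G\<^esub>}"

definition primary_component :: "nat \<Rightarrow> ('a, 'b) ring_scheme \<Rightarrow> 'a set"
  where "primary_component p G =
    {x \<in> torsion G. \<exists>n::nat. n \<ge> 1 \<and> [(p ^ n)] \<cdot>\<^bsub>G\<^esub> x = \<zero>\<^bsub>G\<^esub>}"

definition torsion_module :: "('a, 'b) ring_scheme \<Rightarrow> (int, 'a) module"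
  where "torsion_module G = (int_module G)\<lparr>carrier := torsion G\<rparr>"

definition primary_module :: "nat \<Rightarrow> ('a, 'b) ring_scheme \<Rightarrow> (int, 'a) module"
  where "primary_module p G = (int_module G)\<lparr>carrier := primary_component p G\<rparr>"

lemma (in abelian_group) module_int_module: "module \<Z> (int_module G)"
proof (rule moduleI)
  show "cring \<Z>" by (rule int_is_cring)
  show "abelian_group (int_module G)"
    by (rule abelian_groupI)
       (auto simp: int_module_def a_ac intro: l_neg)
qed (auto simp: int_module_def add.int_pow_mult add.int_pow_distrib add.int_pow_pow mult.commute)

lemma (in abelian_group) submodule_int_moduleI:
  assumes "H \<subseteq> carrier G" "\<zero> \<in> H"
    and "\<And>x y. x \<in> H \<Longrightarrow> y \<in> H \<Longrightarrow> x \<oplus> y \<in> H"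
    and "\<And>(k::int) x. x \<in> H \<Longrightarrow> [k] \<cdot> x \<in> H"
  shows "submodule H \<Z> (int_module G)"
proof -
  interpret M: module \<Z> "int_module G" by (rule module_int_module)
  have sm: "k \<odot>\<^bsub>int_module G\<^esub> x \<in> H" if "x \<in> H" for k x
    using assms(4)[OF that] by (simp add: int_module_def)
  have inv: "\<ominus>\<^bsub>int_module G\<^esub> x \<in> H" if "x \<in> H" for x
  proof -
    have "x \<in> carrier (int_module G)" using that assms(1) by (auto simp: int_module_def)
    then have "(\<ominus>\<^bsub>\<Z>\<^esub> \<one>\<^bsub>\<Z>\<^esub>) \<odot>\<^bsub>int_module G\<^esub> x = \<ominus>\<^bsub>int_module G\<^esub> x"
      using module.smult_l_minus[OF module_int_module int_Zcarr]
        module.smult_one[OF module_int_module] by metis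
    then show ?thesis
      using sm[OF that] by metis
  qed
  show ?thesis
    using assms(1-3) sm inv by (intro M.submoduleI) (auto simp: int_module_def)
qed

lemma (in abelian_group) multiple_annihilates:
  assumes "x \<in> carrier G" "[(n::nat)] \<cdot> x = \<zero>" "n dvd m"
  shows "[m] \<cdot> x = \<zero>"
proof -
  obtain q where "m = n * q" using assms(3) by blast
  then show ?thesis
    using add.nat_pow_pow[OF assms(1), of q n] assms(2) by (simp add: mult.commute)
qed

lemma (in abelian_group) int_multiple_annihilated:
  assumes "x \<in> carrier G" "[(n::nat)] \<cdot> x = \<zero>"
  shows "[n] \<cdot> ([(k::int)] \<cdot> x) = \<zero>"
proof -
  have "[n] \<cdot> ([k] \<cdot> x) = [k] \<cdot> ([(int n)] \<cdot> x)"
    using add.int_pow_pow[OF assms(1), of k "int n"] add.int_pow_pow[OF assms(1), of "int n" k]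
    by (simp add: mult.commute add_pow_def int_pow_int)
  then show ?thesis
    using assms(2) add.int_pow_one[of k] by (simp add: add_pow_def int_pow_int)
qed

lemma (in abelian_group) submodule_torsion: "submodule (torsion G) \<Z> (int_module G)"
proof (rule submodule_int_moduleI)
  show "torsion G \<subseteq> carrier G" by (auto simp: torsion_def)
  show "\<zero> \<in> torsion G" by (auto simp: torsion_def intro: exI[of _ 1])
  fix x assume x: "x \<in> torsion G"
  then obtain n where n: "x \<in> carrier G" "n \<ge> 1" "[(n::nat)] \<cdot> x = \<zero>"
    by (auto simp: torsion_def)
  show "[k] \<cdot> x \<in> torsion G" for k :: int
    using n int_multiple_annihilated[OF n(1,3)] by (auto simp: torsion_def)
  fix y assume "y \<in> torsion G"
  then obtain m where m: "y \<in> carrier G" "m \<ge> 1" "[(m::nat)] \<cdot> y = \<zero>"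
    by (auto simp: torsion_def)
  have "[(n * m)] \<cdot> (x \<oplus> y) = \<zero>"
    using n m multiple_annihilates[of x n "n * m"] multiple_annihilates[of y m "n * m"]
    by (simp add: add.nat_pow_distrib)
  then show "x \<oplus> y \<in> torsion G"
    using n m by (auto simp: torsion_def intro!: exI[of _ "n * m"])
qed

lemma (in abelian_group) submodule_primary_component:
  "submodule (primary_component p G) \<Z> (int_module G)"
proof (rule submodule_int_moduleI)
  interpret T: submodule "torsion G" \<Z> "int_module G" by (rule submodule_torsion)
  show "primary_component p G \<subseteq> carrier G" by (auto simp: primary_component_def torsion_def)
  show "\<zero> \<in> primary_component p G"
    by (auto simp: primary_component_def torsion_def intro: exI[of _ 1])
  fix x assume x: "x \<in> primary_component p G"
  then obtain n where n: "x \<in> torsion G" "x \<in> carrier G" "n \<ge> 1" "[(p ^ n)] \<cdot> x = \<zero>"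
    by (auto simp: primary_component_def torsion_def)
  show "[k] \<cdot> x \<in> primary_component p G" for k :: int
    using n int_multiple_annihilated[OF n(2,4)] T.smult_closed[of k x]
    by (auto simp: primary_component_def int_module_def)
  fix y assume "y \<in> primary_component p G"
  then obtain m where m: "y \<in> torsion G" "y \<in> carrier G" "m \<ge> 1" "[(p ^ m)] \<cdot> y = \<zero>"
    by (auto simp: primary_component_def torsion_def)
  have "[(p ^ (n + m))] \<cdot> (x \<oplus> y) = \<zero>"
    using n m multiple_annihilates[of x "p ^ n" "p ^ (n + m)"]
      multiple_annihilates[of y "p ^ m" "p ^ (n + m)"]
    by (simp add: add.nat_pow_distrib power_add)
  moreover have "x \<oplus> y \<in> torsion G"
    using T.m_closed[of x y] n m by (simp add: int_module_def)
  ultimately show "x \<oplus> y \<in> primary_component p G"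
    using n by (auto simp: primary_component_def intro!: exI[of _ "n + m"])
qed

end

theory Submission
  imports Defs
begin

text \<open>
  The simple submodules of an abelian group \<open>M\<close> are the subgroups of prime order \<open>p\<close>, which for
  given \<open>p\<close> are all isomorphic. Such a subgroup, generated by \<open>x\<close>, is a direct summand iff
  \<open>x \<notin> pM\<close>: a subgroup maximal among those that contain \<open>pM\<close> and avoid \<open>x\<close> is a maximal subgroup,
  hence a complement. So \<open>M\<close> is simple-direct-injective iff for each prime \<open>p\<close> the socle
  \<open>M[p] = {x. px = 0}\<close> satisfies \<open>M[p] \<inter> pM = 0\<close> or \<open>M[p] \<subseteq> pM\<close>. This condition at \<open>p\<close> only
  involves elements killed by \<open>p\<^sup>2\<close>, so it is the same for \<open>M\<close>, \<open>T(M)\<close> and \<open>T\<^sub>p(M)\<close>. For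
  \<open>P = T\<^sub>p(M)\<close> one has \<open>soc(P) = P[p]\<close> and \<open>rad(P) = pP\<close>, and \<open>P[p] \<inter> pP = 0\<close> forces \<open>pP = 0\<close>.
\<close>

section \<open>Modules over the integers\<close>

locale Z_module = module "\<Z>" M for M (structure)
begin

lemma smult_carrier [simp, intro]: "x \<in> carrier M \<Longrightarrow> k \<odot> x \<in> carrier M"
  by (rule smult_closed) auto

lemma add_smult: "x \<in> carrier M \<Longrightarrow> (a + b) \<odot> x = a \<odot> x \<oplus> b \<odot> x"
  using smult_l_distr[of a b x] by simp

lemma smult_add: "x \<in> carrier M \<Longrightarrow> y \<in> carrier M \<Longrightarrow> a \<odot> (x \<oplus> y) = a \<odot> x \<oplus> a \<odot> y"
  using smult_r_distr[of a x y] by simp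

lemma mult_smult: "x \<in> carrier M \<Longrightarrow> (a * b) \<odot> x = a \<odot> (b \<odot> x)"
  using smult_assoc1[of a b x] by simp

lemma one_smult [simp]: "x \<in> carrier M \<Longrightarrow> 1 \<odot> x = x"
  using smult_one[of x] by simp

lemma zero_smult [simp]: "x \<in> carrier M \<Longrightarrow> 0 \<odot> x = \<zero>"
  using smult_l_null[of x] by simp

lemma smult_zero [simp]: "k \<odot> \<zero> = \<zero>"
  by (rule smult_r_null) auto

lemma minus_smult: "x \<in> carrier M \<Longrightarrow> (- a) \<odot> x = \<ominus> (a \<odot> x)"
  using smult_l_minus[of a x] by (simp add: int_a_inv_eq)

lemma smult_commute: "x \<in> carrier M \<Longrightarrow> a \<odot> (b \<odot> x) = b \<odot> (a \<odot> x)"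
  by (simp flip: mult_smult add: mult.commute)

text \<open>Over the integers negation is scaling by -1 and zero arises by scaling with 0, so
  closure under sums and scalars suffices once zero replaces nonemptiness.\<close>

lemma submodule_Z_iff:
  "submodule H \<Z> M \<longleftrightarrow> H \<subseteq> carrier M \<and> \<zero> \<in> H \<and>
     (\<forall>x\<in>H. \<forall>y\<in>H. x \<oplus> y \<in> H) \<and> (\<forall>k. \<forall>x\<in>H. k \<odot> x \<in> H)"
  (is "?L \<longleftrightarrow> ?R")
proof
  assume H: ?L
  then obtain h where "h \<in> H" "h \<in> carrier M" using submoduleE(1,2)[OF H] by blast
  then have "\<zero> \<in> H" using submoduleE(4)[OF H, of 0 h] by simp
  then show ?R using submoduleE[OF H] by auto
next
  assume R: ?R
  show ?L
  proof (rule submoduleI)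
    fix a assume "a \<in> H"
    then show "\<ominus> a \<in> H" using R minus_smult[of a 1] by (metis one_smult subsetD)
  qed (use R in auto)
qed

lemma submodule_carrier: "submodule H \<Z> M \<Longrightarrow> H \<subseteq> carrier M"
  and submodule_zero: "submodule H \<Z> M \<Longrightarrow> \<zero> \<in> H"
  and submodule_add: "submodule H \<Z> M \<Longrightarrow> x \<in> H \<Longrightarrow> y \<in> H \<Longrightarrow> x \<oplus> y \<in> H"
  and submodule_smult: "submodule H \<Z> M \<Longrightarrow> x \<in> H \<Longrightarrow> k \<odot> x \<in> H"
  by (auto simp: submodule_Z_iff)

lemma Z_module_submodule:
  assumes "submodule H \<Z> M"
  shows "Z_module (M\<lparr>carrier := H\<rparr>)"
  using submodule.submodule_is_module[OF assms module_axioms] by (simp add: Z_module_def)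

lemma submodule_submodule_iff:
  assumes "submodule H \<Z> M"
  shows "submodule N \<Z> (M\<lparr>carrier := H\<rparr>) \<longleftrightarrow> N \<subseteq> H \<and> submodule N \<Z> M"
  using submodule_carrier[OF assms]
  unfolding Z_module.submodule_Z_iff[OF Z_module_submodule[OF assms]] submodule_Z_iff by auto

lemma mem_set_add_iff: "x \<in> A <+>\<^bsub>M\<^esub> B \<longleftrightarrow> (\<exists>a\<in>A. \<exists>b\<in>B. x = a \<oplus> b)"
  by (auto simp: set_add_def')

lemma submodule_set_add:
  assumes A: "submodule A \<Z> M" and B: "submodule B \<Z> M"
  shows "submodule (A <+>\<^bsub>M\<^esub> B) \<Z> M"
  unfolding submodule_Z_iff
proof (intro conjI ballI allI)
  note c = submodule_carrier[OF A, THEN subsetD] submodule_carrier[OF B, THEN subsetD]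
  show "A <+>\<^bsub>M\<^esub> B \<subseteq> carrier M" using c by (auto simp: mem_set_add_iff)
  show "\<zero> \<in> A <+>\<^bsub>M\<^esub> B"
    using submodule_zero[OF A] submodule_zero[OF B] by (force simp: mem_set_add_iff)
  fix x assume "x \<in> A <+>\<^bsub>M\<^esub> B"
  then obtain a b where x: "a \<in> A" "b \<in> B" "x = a \<oplus> b" by (auto simp: mem_set_add_iff)
  show "k \<odot> x \<in> A <+>\<^bsub>M\<^esub> B" for k
    unfolding mem_set_add_iff x(3) smult_add[OF c(1)[OF x(1)] c(2)[OF x(2)]]
    using x submodule_smult[OF A] submodule_smult[OF B] by blast
  fix y assume "y \<in> A <+>\<^bsub>M\<^esub> B"
  then obtain a' b' where y: "a' \<in> A" "b' \<in> B" "y = a' \<oplus> b'" by (auto simp: mem_set_add_iff)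
  have "x \<oplus> y = (a \<oplus> a') \<oplus> (b \<oplus> b')" using x y c by (simp add: a_ac)
  then show "x \<oplus> y \<in> A <+>\<^bsub>M\<^esub> B"
    unfolding mem_set_add_iff
    using submodule_add[OF A x(1) y(1)] submodule_add[OF B x(2) y(2)] by blast
qed

lemma set_add_left: "submodule B \<Z> M \<Longrightarrow> A \<subseteq> carrier M \<Longrightarrow> A \<subseteq> A <+>\<^bsub>M\<^esub> B"
  using submodule_zero[of B] by (force simp: mem_set_add_iff)

lemma set_add_right: "submodule A \<Z> M \<Longrightarrow> B \<subseteq> carrier M \<Longrightarrow> B \<subseteq> A <+>\<^bsub>M\<^esub> B"
  using submodule_zero[of A] by (force simp: mem_set_add_iff)

text \<open>Bezout: if u a + v b = 1, then x = u (a x) + v (b x). This replaces all reasoning about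
  orders of elements and about inverses modulo p.\<close>

lemma coprime_smult_mem:
  assumes N: "submodule N \<Z> M" and x: "x \<in> carrier M"
    and "a \<odot> x \<in> N" "b \<odot> x \<in> N" "coprime a b"
  shows "x \<in> N"
proof -
  obtain u v :: int where uv: "u * a + v * b = 1"
    using bezout_int[of a b] \<open>coprime a b\<close> by (auto simp: coprime_iff_gcd_eq_1)
  have "x = (u * a + v * b) \<odot> x" using x uv by simp
  also have "\<dots> = u \<odot> (a \<odot> x) \<oplus> v \<odot> (b \<odot> x)" using x by (simp add: add_smult mult_smult)
  also have "\<dots> \<in> N" using assms submodule_add[OF N] submodule_smult[OF N] by simp
  finally show ?thesis .
qed

definition cyclic :: "'a \<Rightarrow> 'a set"
  where "cyclic x = range (\<lambda>k::int. k \<odot> x)"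

lemma submodule_cyclic: "x \<in> carrier M \<Longrightarrow> submodule (cyclic x) \<Z> M"
  unfolding submodule_Z_iff cyclic_def
  by (auto simp flip: add_smult mult_smult intro: image_eqI[where x = 0])

lemma cyclic_self: "x \<in> carrier M \<Longrightarrow> x \<in> cyclic x"
  unfolding cyclic_def by (rule image_eqI[where x = 1]) auto

lemma cyclic_subset: "submodule N \<Z> M \<Longrightarrow> x \<in> N \<Longrightarrow> cyclic x \<subseteq> N"
  unfolding cyclic_def using submodule_smult by auto

section \<open>Elements killed by p and multiples of p\<close>

definition socle_at :: "int \<Rightarrow> 'a set"
  where "socle_at p = {x \<in> carrier M. p \<odot> x = \<zero>}"

definition multiples :: "int \<Rightarrow> 'a set"
  where "multiples p = (\<lambda>y. p \<odot> y) ` carrier M"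

lemma socle_atD: "x \<in> socle_at p \<Longrightarrow> x \<in> carrier M" "x \<in> socle_at p \<Longrightarrow> p \<odot> x = \<zero>"
  by (auto simp: socle_at_def)

lemma submodule_socle_at: "submodule (socle_at p) \<Z> M"
  unfolding submodule_Z_iff socle_at_def by (auto simp: smult_add smult_commute[of _ p])

lemma submodule_multiples: "submodule (multiples p) \<Z> M"
  unfolding submodule_Z_iff multiples_def
  by (auto simp flip: smult_add simp: smult_commute[of _ _ p] intro: image_eqI[where x = \<zero>])

text \<open>If p does not divide k, then k is coprime to p; since both kill x, Bezout with the zero
  submodule forces x = 0.\<close>

lemma smult_socle_at_eq_zero_iff:
  assumes "prime p" "x \<in> socle_at p" "x \<noteq> \<zero>"
  shows "k \<odot> x = \<zero> \<longleftrightarrow> p dvd k"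
proof
  assume k: "k \<odot> x = \<zero>"
  have "submodule {\<zero>} \<Z> M" unfolding submodule_Z_iff by auto
  then show "p dvd k"
    using coprime_smult_mem[of "{\<zero>}" x p k] assms k prime_imp_coprime[of p k] socle_atD[of x p] by auto
next
  assume "p dvd k"
  then show "k \<odot> x = \<zero>" using assms
    by (auto simp: mult_smult smult_commute[of _ p] socle_atD elim!: dvdE)
qed

section \<open>Simple submodules as subgroups of prime order\<close>

lemma simple_submodule_iff':
  "simple_submodule A \<Z> M \<longleftrightarrow> submodule A \<Z> M \<and> A \<noteq> {\<zero>} \<and>
     (\<forall>N. submodule N \<Z> M \<longrightarrow> N \<subseteq> A \<longrightarrow> N = {\<zero>} \<or> N = A)"
  using Z_module_submodule[of A] submodule_submodule_iff[of A]
  by (auto simp: simple_submodule_def simple_module_def Z_module_def)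

lemma simple_submodule_eq_cyclic:
  assumes A: "simple_submodule A \<Z> M" and "x \<in> A" "x \<noteq> \<zero>"
  shows "A = cyclic x"
proof -
  have s: "submodule A \<Z> M" using A by (simp add: simple_submodule_iff')
  then have x: "x \<in> carrier M" using assms submodule_carrier by auto
  show ?thesis
    using A assms submodule_cyclic[OF x] cyclic_subset[OF s] cyclic_self[OF x]
    unfolding simple_submodule_iff' by blast
qed

text \<open>A nonzero element k x of a submodule N has k coprime to p. As p x = 0 lies in N too,
  Bezout puts the generator x into N.\<close>

lemma simple_submodule_cyclic:
  assumes p: "prime p" and x: "x \<in> socle_at p" "x \<noteq> \<zero>"
  shows "simple_submodule (cyclic x) \<Z> M"
  unfolding simple_submodule_iff'
proof (intro conjI allI impI)
  note xc = socle_atD[OF x(1)]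
  show "submodule (cyclic x) \<Z> M" using submodule_cyclic xc by simp
  show "cyclic x \<noteq> {\<zero>}" using cyclic_self xc x by auto
  fix N assume N: "submodule N \<Z> M" "N \<subseteq> cyclic x"
  have "cyclic x \<subseteq> N" if nz: "N \<noteq> {\<zero>}"
  proof -
    obtain y where y: "y \<in> N" "y \<noteq> \<zero>" using nz submodule_zero[OF N(1)] by auto
    then obtain k :: int where k: "y = k \<odot> x" using N(2) by (auto simp: cyclic_def)
    then have "coprime p k"
      using y smult_socle_at_eq_zero_iff[OF p x, of k] prime_imp_coprime[OF p, of k] by blast
    then have "x \<in> N"
      using coprime_smult_mem[OF N(1), of x p k] y k xc submodule_zero[OF N(1)] by auto
    then show ?thesis using cyclic_subset N by blast
  qed
  then show "N = {\<zero>} \<or> N = cyclic x" using N by blast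
qed

text \<open>A nonzero element x turns out to be torsion. If n is the least positive integer killing
  it and p is a prime factor, n = p m, then m x is nonzero, is killed by p, and generates A by
  simplicity.\<close>

lemma simple_submodule_socle_at:
  assumes A: "simple_submodule A \<Z> M"
  obtains p x where "prime (p :: int)" "x \<in> socle_at p" "x \<noteq> \<zero>" "A = cyclic x"
proof -
  have s: "submodule A \<Z> M" and "A \<noteq> {\<zero>}" using A by (auto simp: simple_submodule_iff')
  then obtain x where x: "x \<in> A" "x \<noteq> \<zero>" using submodule_zero by blast
  have xc: "x \<in> carrier M" using submodule_carrier s x by blast
  \<comment> \<open>Either 2 kills x, or 2 x generates A by simplicity. In the latter case x = 2 k x
    for some k, so the odd, hence nonzero, integer 2 k - 1 kills x.\<close>
  have "\<exists>n::nat. n > 0 \<and> int n \<odot> x = \<zero>"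
  proof (cases "2 \<odot> x = \<zero>")
    case True
    then show ?thesis by (intro exI[of _ 2]) auto
  next
    case False
    then have "x \<in> cyclic (2 \<odot> x)"
      using simple_submodule_eq_cyclic[OF A, of "2 \<odot> x"] submodule_smult[OF s] x by auto
    then obtain k :: int where "x = (2 * k) \<odot> x"
      using xc by (auto simp: cyclic_def mult_smult smult_commute[of _ 2])
    then have *: "(2 * k + - 1) \<odot> x = \<zero>"
      using xc by (simp only: add_smult minus_smult one_smult) (simp add: M.r_neg)
    have "int (nat \<bar>2 * k - 1\<bar>) \<odot> x = \<zero>"
    proof (cases "2 * k - 1 \<ge> 0")
      case False
      then have "int (nat \<bar>2 * k - 1\<bar>) = - (2 * k + - 1)" by simp
      then show ?thesis using * xc by (simp only: minus_smult) simp
    qed (use * in simp)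
    moreover have "2 * k - 1 \<noteq> 0" by presburger
    ultimately show ?thesis by (intro exI[of _ "nat \<bar>2 * k - 1\<bar>"]) auto
  qed
  then obtain n :: nat where n: "n > 0" "int n \<odot> x = \<zero>"
    and min: "\<And>m. m > 0 \<Longrightarrow> int m \<odot> x = \<zero> \<Longrightarrow> n \<le> m"
    using LeastI_ex[of "\<lambda>n::nat. n > 0 \<and> int n \<odot> x = \<zero>"]
      Least_le[of "\<lambda>n::nat. n > 0 \<and> int n \<odot> x = \<zero>"] by auto
  have "n \<noteq> 1" using n x xc by auto
  then obtain p where p: "prime p" "p dvd n" using prime_factor_nat by blast
  then obtain m where m: "n = p * m" by blast
  then have "m > 0" "m < n" using n p prime_gt_1_nat[of p] by auto
  then have "int m \<odot> x \<noteq> \<zero>" using min[of m] by auto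
  moreover have "int p \<odot> (int m \<odot> x) = \<zero>" using n m xc by (simp flip: mult_smult)
  moreover have "int m \<odot> x \<in> A" using submodule_smult s x by blast
  ultimately show ?thesis
    using that[of "int p" "int m \<odot> x"] simple_submodule_eq_cyclic[OF A] p xc
    by (auto simp: socle_at_def)
qed

section \<open>Direct summands of prime order\<close>

text \<open>Zorn's lemma gives C maximal among the submodules that contain all multiples of p and
  avoid x. A strictly larger L contains x; for y outside C, x also lies in C +
  \<open>cyclic y\<close>, which puts into L a multiple k y with k prime to p. Since p y lies in C,
  Bezout gives y in L.\<close>

lemma maximal_submodule_avoiding:
  assumes p: "prime p" and x: "x \<in> carrier M" "x \<notin> multiples p"
  obtains C where "maximal_submodule C \<Z> M" "x \<notin> C"
proof -
  let ?S = "{C. submodule C \<Z> M \<and> multiples p \<subseteq> C \<and> x \<notin> C}"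
  have "\<exists>C\<in>?S. \<forall>X\<in>?S. C \<subseteq> X \<longrightarrow> X = C"
  proof (rule subset_Zorn_nonempty)
    show "?S \<noteq> {}" using x submodule_multiples by blast
    fix K assume K: "K \<noteq> {}" "subset.chain ?S K"
    \<comment> \<open>Two members of a chain are comparable, so the sum is formed in the larger
      one.\<close>
    have "a \<oplus> b \<in> \<Union>K" if "A \<in> K" "a \<in> A" "B \<in> K" "b \<in> B" for a b A B
    proof -
      have "A \<subseteq> B \<or> B \<subseteq> A" using K that by (auto simp: subset.chain_def)
      then show ?thesis
        using that K submodule_add[of A a b] submodule_add[of B a b]
        by (auto simp: subset.chain_def subset_iff)
    qed
    moreover have "\<And>A. A \<in> K \<Longrightarrow> submodule A \<Z> M"
      using K by (auto simp: subset.chain_def)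
    ultimately have "submodule (\<Union>K) \<Z> M"
      using K unfolding submodule_Z_iff by blast
    then show "\<Union>K \<in> ?S" using K by (auto simp: subset.chain_def)
  qed
  then obtain C where "C \<in> ?S" and "\<forall>X\<in>?S. C \<subseteq> X \<longrightarrow> X = C" by (rule bexE)
  then have C: "submodule C \<Z> M" "multiples p \<subseteq> C" "x \<notin> C"
    and max: "\<And>X. submodule X \<Z> M \<Longrightarrow> C \<subseteq> X \<Longrightarrow> x \<notin> X \<Longrightarrow> X = C" by auto
  have "maximal_submodule C \<Z> M"
    unfolding maximal_submodule_def
  proof (intro conjI allI impI)
    show "C \<noteq> carrier M" using C x by auto
    fix L assume L: "submodule L \<Z> M" "C \<subseteq> L"
    have "L = carrier M" if "L \<noteq> C"
    proof (intro equalityI subsetI)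
      have xL: "x \<in> L" using max L that by blast
      fix y assume y: "y \<in> carrier M"
      show "y \<in> L"
      proof (cases "y \<in> C")
        case False
        note s = submodule_cyclic[OF y]
        have "C \<subseteq> C <+>\<^bsub>M\<^esub> cyclic y" "y \<in> C <+>\<^bsub>M\<^esub> cyclic y"
          using set_add_left[OF s submodule_carrier[OF C(1)]]
            set_add_right[OF C(1) submodule_carrier[OF s]] cyclic_self[OF y] by auto
        then have "x \<in> C <+>\<^bsub>M\<^esub> cyclic y"
          using max[OF submodule_set_add[OF C(1) s]] False by blast
        then obtain c k where ck: "c \<in> C" "x = c \<oplus> k \<odot> y"
          by (auto simp: mem_set_add_iff cyclic_def)
        have py: "p \<odot> y \<in> C" using C y by (auto simp: multiples_def)
        \<comment> \<open>Otherwise k y is a multiple of p y, so it lies in C, and then so does x =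
          c + k y.\<close>
        have "\<not> p dvd k"
        proof
          assume "p dvd k"
          then have "k \<odot> y \<in> C"
            using y py submodule_smult[OF C(1)]
            by (auto simp: mult_smult smult_commute[of _ p] elim!: dvdE)
          then show False using ck C submodule_add[OF C(1)] by simp
        qed
        moreover have "k \<odot> y \<in> L"
        proof -
          have cc: "c \<in> carrier M" using submodule_carrier C ck by blast
          have "k \<odot> y = (- 1) \<odot> c \<oplus> x"
            using cc y ck by (simp add: minus_smult[of _ 1] M.r_neg1)
          moreover have "(- 1) \<odot> c \<in> L" using L ck submodule_smult[OF L(1)] by blast
          ultimately show ?thesis using xL submodule_add[OF L(1)] by simp
        qed
        ultimately show ?thesis
          using coprime_smult_mem[OF L(1) y, of p k] py L p prime_imp_coprime[of p k] by blast
      qed (use L in auto)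
    qed (use submodule_carrier L in auto)
    then show "L = C \<or> L = carrier M" by blast
  qed (use C in simp)
  then show ?thesis using that C by blast
qed

text \<open>If x = p y and C is a complement, write y = k x + c; multiplying by p kills the first
  term, so x = p c lies in C, which is impossible. Conversely, a maximal submodule avoiding x is a
  complement.\<close>

lemma direct_summand_cyclic_iff:
  assumes p: "prime p" and x: "x \<in> socle_at p" "x \<noteq> \<zero>"
  shows "direct_summand (cyclic x) \<Z> M \<longleftrightarrow> x \<notin> multiples p"
proof -
  note xc = socle_atD[OF x(1)]
  note s = submodule_cyclic[OF xc(1)]
  show ?thesis
  proof
    assume "direct_summand (cyclic x) \<Z> M"
    then obtain C where C: "submodule C \<Z> M" "cyclic x \<inter> C = {\<zero>}" "cyclic x <+>\<^bsub>M\<^esub> C = carrier M"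
      by (auto simp: direct_summand_def)
    show "x \<notin> multiples p"
    proof
      assume "x \<in> multiples p"
      then obtain y where y: "y \<in> carrier M" "x = p \<odot> y" by (auto simp: multiples_def)
      then have "y \<in> cyclic x <+>\<^bsub>M\<^esub> C" using C(3) by simp
      then obtain k c where kc: "c \<in> C" "y = k \<odot> x \<oplus> c"
        by (auto simp: mem_set_add_iff cyclic_def)
      have cc: "c \<in> carrier M" using submodule_carrier C kc by blast
      have "x = p \<odot> (k \<odot> x \<oplus> c)" using y(2) unfolding kc(2) .
      also have "\<dots> = p \<odot> (k \<odot> x) \<oplus> p \<odot> c" using cc xc by (simp add: smult_add)
      also have "\<dots> = p \<odot> c" using xc cc by (simp add: smult_commute[of _ p])
      finally have "x \<in> C" using submodule_smult C kc by simp
      then show False using C(2) cyclic_self[OF xc(1)] x by blast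
    qed
  next
    assume "x \<notin> multiples p"
    then obtain C where C: "maximal_submodule C \<Z> M" "x \<notin> C"
      using maximal_submodule_avoiding p xc by blast
    then have sC: "submodule C \<Z> M" by (simp add: maximal_submodule_def)
    \<comment> \<open>If p did not divide k, then k x and p x = 0 in C would give x in C by
      Bezout.\<close>
    have "k \<odot> x = \<zero>" if "k \<odot> x \<in> C" for k :: int
      using coprime_smult_mem[OF sC, of x p k] that C xc p submodule_zero[OF sC]
        prime_imp_coprime[of p k] smult_socle_at_eq_zero_iff[OF p x] by auto
    then have "cyclic x \<inter> C = {\<zero>}"
      using submodule_zero[OF sC] submodule_zero[OF s] by (auto simp: cyclic_def)
    moreover have "C \<subseteq> cyclic x <+>\<^bsub>M\<^esub> C" "x \<in> cyclic x <+>\<^bsub>M\<^esub> C"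
      using set_add_right[OF s submodule_carrier[OF sC]]
        set_add_left[OF sC submodule_carrier[OF s]] cyclic_self[OF xc(1)] by auto
    then have "cyclic x <+>\<^bsub>M\<^esub> C = carrier M"
      using C submodule_set_add[OF s sC] unfolding maximal_submodule_def by blast
    ultimately show "direct_summand (cyclic x) \<Z> M"
      using s sC by (auto simp: direct_summand_def)
  qed
qed

section \<open>Isomorphic simple submodules and the criterion prime by prime\<close>

text \<open>The map k x to k y is well defined and injective because on both sides two coefficients
  give the same element exactly when they agree modulo p.\<close>

lemma module_iso_cyclic:
  assumes p: "prime p" and x: "x \<in> socle_at p" "x \<noteq> \<zero>" and y: "y \<in> socle_at p" "y \<noteq> \<zero>"
  shows "module_iso \<Z> (M\<lparr>carrier := cyclic x\<rparr>) (M\<lparr>carrier := cyclic y\<rparr>) \<noteq> {}"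
proof -
  have eq_iff: "a \<odot> z = b \<odot> z \<longleftrightarrow> p dvd a - b" if z: "z \<in> socle_at p" "z \<noteq> \<zero>" for z a b
  proof -
    have zc: "z \<in> carrier M" using z socle_atD by auto
    have "a \<odot> z = (a - b) \<odot> z \<oplus> b \<odot> z" using add_smult[OF zc, of "a - b" b] by simp
    then have "a \<odot> z = b \<odot> z \<longleftrightarrow> (a - b) \<odot> z = \<zero>" using zc by simp
    then show ?thesis using smult_socle_at_eq_zero_iff[OF p z] by simp
  qed
  \<comment> \<open>The coefficient of z is picked arbitrarily; by \<open>eq_iff\<close> the choice
    matters only modulo p, which does not affect its product with y.\<close>
  define f where "f z = (SOME k. z = k \<odot> x) \<odot> y" for z
  have f: "f (k \<odot> x) = k \<odot> y" for k
  proof -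
    have "k \<odot> x = (SOME j. k \<odot> x = j \<odot> x) \<odot> x" by (rule someI) auto
    then have "p dvd k - (SOME j. k \<odot> x = j \<odot> x)" using eq_iff[OF x] by blast
    then have "k \<odot> y = (SOME j. k \<odot> x = j \<odot> x) \<odot> y" using eq_iff[OF y] by blast
    then show ?thesis by (simp add: f_def)
  qed
  have "bij_betw f (cyclic x) (cyclic y)"
    unfolding bij_betw_def inj_on_def cyclic_def
    using f eq_iff[OF x] eq_iff[OF y] by (auto simp: image_image)
  then have "f \<in> module_iso \<Z> (M\<lparr>carrier := cyclic x\<rparr>) (M\<lparr>carrier := cyclic y\<rparr>)"
    using socle_atD[OF x(1)] socle_atD[OF y(1)]
    by (auto simp: module_iso_def cyclic_def f simp flip: add_smult mult_smult)
  then show ?thesis by blast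
qed

text \<open>An isomorphism preserves the prime attached to a simple submodule. That f fixes zero is
  read off from scaling by 0.\<close>

lemma module_iso_socle_at:
  assumes f: "f \<in> module_iso \<Z> (M\<lparr>carrier := A\<rparr>) (M\<lparr>carrier := B\<rparr>)"
    and A: "submodule A \<Z> M" and B: "submodule B \<Z> M"
    and x: "x \<in> socle_at p" "x \<in> A" "x \<noteq> \<zero>"
  shows "f x \<in> socle_at p" "f x \<in> B" "f x \<noteq> \<zero>"
proof -
  have bij: "bij_betw f A B" and sm: "\<And>k z. z \<in> A \<Longrightarrow> f (k \<odot> z) = k \<odot> f z"
    using f by (auto simp: module_iso_def)
  show fx: "f x \<in> B" using bij x by (auto simp: bij_betw_def)
  then have fc: "f x \<in> carrier M" using submodule_carrier[OF B] by blast
  have f0: "f \<zero> = \<zero>" using sm[OF x(2), of 0] fc socle_atD[OF x(1)] by simp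
  show "f x \<in> socle_at p" using sm[OF x(2), of p] f0 fc socle_atD[OF x(1)] by (simp add: socle_at_def)
  show "f x \<noteq> \<zero>"
    using bij x f0 submodule_zero[OF A] by (metis bij_betw_def inj_onD)
qed

text \<open>For prime p the first alternative says that every subgroup of order p is a direct
  summand, the second that none is.\<close>

definition socle_dichotomy :: "int \<Rightarrow> bool"
  where "socle_dichotomy p \<longleftrightarrow> socle_at p \<inter> multiples p \<subseteq> {\<zero>} \<or> socle_at p \<subseteq> multiples p"

text \<open>Simple submodules are isomorphic exactly when they belong to the same prime, so the
  property says that for each prime the subgroups of that order are all summands or none is.\<close>

lemma simple_direct_injective_iff:
  "simple_direct_injective \<Z> M \<longleftrightarrow> (\<forall>p. prime p \<longrightarrow> socle_dichotomy p)"
proof (intro iffI allI impI)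
  fix p :: int
  assume sdi: "simple_direct_injective \<Z> M" and p: "prime p"
  show "socle_dichotomy p"
  proof (rule ccontr)
    assume "\<not> socle_dichotomy p"
    then obtain x y where x: "x \<in> socle_at p" "x \<noteq> \<zero>" "x \<in> multiples p"
      and y: "y \<in> socle_at p" "y \<notin> multiples p"
      by (auto simp: socle_dichotomy_def)
    have y0: "y \<noteq> \<zero>" using y submodule_zero[OF submodule_multiples] by auto
    have "direct_summand (cyclic x) \<Z> M"
      using sdi simple_submodule_cyclic[OF p x(1,2)] simple_submodule_cyclic[OF p y(1) y0]
        module_iso_cyclic[OF p x(1,2) y(1) y0] direct_summand_cyclic_iff[OF p y(1) y0] y
      unfolding simple_direct_injective_def by blast
    then show False using direct_summand_cyclic_iff[OF p x(1,2)] x by blast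
  qed
next
  assume d: "\<forall>p. prime p \<longrightarrow> socle_dichotomy p"
  show "simple_direct_injective \<Z> M"
    unfolding simple_direct_injective_def
  proof (intro allI impI)
    fix A B
    assume A: "simple_submodule A \<Z> M" and B: "simple_submodule B \<Z> M"
      and iso: "module_iso \<Z> (M\<lparr>carrier := A\<rparr>) (M\<lparr>carrier := B\<rparr>) \<noteq> {}"
      and dB: "direct_summand B \<Z> M"
    obtain p x where p: "prime p" and x: "x \<in> socle_at p" "x \<noteq> \<zero>" "A = cyclic x"
      by (rule simple_submodule_socle_at[OF A])
    obtain f where f: "f \<in> module_iso \<Z> (M\<lparr>carrier := A\<rparr>) (M\<lparr>carrier := B\<rparr>)" using iso by blast
    have "x \<in> A" using x cyclic_self socle_atD by blast
    then have y: "f x \<in> socle_at p" "f x \<in> B" "f x \<noteq> \<zero>"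
      using module_iso_socle_at[OF f _ _ x(1) _ x(2)] A B by (auto simp: simple_submodule_def)
    then have "f x \<notin> multiples p"
      using direct_summand_cyclic_iff[OF p y(1,3)] dB simple_submodule_eq_cyclic[OF B y(2,3)] by simp
    then have "x \<notin> multiples p"
      using d p x y unfolding socle_dichotomy_def by blast
    then show "direct_summand A \<Z> M" using direct_summand_cyclic_iff[OF p x(1,2)] x by simp
  qed
qed

text \<open>If x = p y and p x = 0, then p * p kills y. A submodule with all such y therefore has
  the same p-socle, and the same elements of it are multiples of p.\<close>

lemma socle_dichotomy_submodule:
  assumes H: "submodule H \<Z> M" and "\<And>y. y \<in> carrier M \<Longrightarrow> (p * p) \<odot> y = \<zero> \<Longrightarrow> y \<in> H"
  shows "Z_module.socle_dichotomy (M\<lparr>carrier := H\<rparr>) p \<longleftrightarrow> socle_dichotomy p"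
proof -
  interpret H: Z_module "M\<lparr>carrier := H\<rparr>" by (rule Z_module_submodule[OF H])
  note Hc = submodule_carrier[OF H]
  have "y \<in> H" if "y \<in> carrier M" "p \<odot> (p \<odot> y) = \<zero>" for y
    using assms(2)[OF that(1)] that by (simp add: mult_smult)
  then have 1: "H.socle_at p = socle_at p" "H.socle_at p \<inter> H.multiples p = socle_at p \<inter> multiples p"
    using Hc by (auto simp: socle_at_def multiples_def H.socle_at_def H.multiples_def)
  \<comment> \<open>Inclusion of the socle in the multiples is recovered from the intersection,
    being equivalent to its equality with the socle.\<close>
  then have "H.socle_at p \<subseteq> H.multiples p \<longleftrightarrow> socle_at p \<subseteq> multiples p" by blast
  with 1 show ?thesis by (simp add: socle_dichotomy_def H.socle_dichotomy_def)
qed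

end

section \<open>Primary modules\<close>

locale primary_Z_module = Z_module +
  fixes p :: int
  assumes prime_p: "prime p"
    and primary: "x \<in> carrier M \<Longrightarrow> \<exists>n. p ^ n \<odot> x = \<zero>"
begin

text \<open>A nonzero x killed by q and by some power of p would make q divide that power.\<close>

lemma socle_at_other_prime:
  assumes "prime q" "q \<noteq> p"
  shows "socle_at q = {\<zero>}"
proof -
  have "x = \<zero>" if x: "x \<in> socle_at q" for x
  proof (rule ccontr)
    assume "x \<noteq> \<zero>"
    obtain n where "p ^ n \<odot> x = \<zero>" using primary socle_atD[OF x] by blast
    then have "q dvd p ^ n" using smult_socle_at_eq_zero_iff[OF assms(1) x] \<open>x \<noteq> \<zero>\<close> by simp
    then show False using assms prime_p by (metis prime_dvd_power primes_dvd_imp_eq)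
  qed
  then show ?thesis using submodule_zero[OF submodule_socle_at] by blast
qed

lemma simple_direct_injective_primary:
  "simple_direct_injective \<Z> M \<longleftrightarrow> socle_dichotomy p"
  unfolding simple_direct_injective_iff
  using socle_at_other_prime prime_p by (auto simp: socle_dichotomy_def)

section \<open>Socle, radical and semisimplicity of a primary module\<close>

text \<open>Every simple submodule belongs to the prime p, so \<open>socle_at p\<close> is one of
  the submodules intersected in \<open>soc\<close>. Conversely, each nonzero element of it generates
  a simple submodule.\<close>

lemma soc_primary: "soc \<Z> M = socle_at p"
proof
  have "A \<subseteq> socle_at p" if "simple_submodule A \<Z> M" for A
  proof -
    obtain q x where q: "prime q" "x \<in> socle_at q" "x \<noteq> \<zero>" "A = cyclic x"
      by (rule simple_submodule_socle_at[OF \<open>simple_submodule A \<Z> M\<close>])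
    then have "q = p" using socle_at_other_prime by blast
    then show ?thesis using q cyclic_subset[OF submodule_socle_at] by blast
  qed
  then show "soc \<Z> M \<subseteq> socle_at p"
    unfolding soc_def sum_of_submodules_def using submodule_socle_at by (intro Inter_lower) auto
  show "socle_at p \<subseteq> soc \<Z> M"
  proof
    fix x assume x: "x \<in> socle_at p"
    have "x \<in> N" if N: "submodule N \<Z> M" "\<Union>{A. simple_submodule A \<Z> M} \<subseteq> N" for N
    proof (cases "x = \<zero>")
      case False
      then have "cyclic x \<subseteq> N" using simple_submodule_cyclic[OF prime_p x] N by blast
      then show ?thesis using cyclic_self socle_atD[OF x] by blast
    qed (use submodule_zero N in simp)
    then show "x \<in> soc \<Z> M" by (auto simp: soc_def sum_of_submodules_def)
  qed
qed

text \<open>Elements outside the multiples of p are avoided by some maximal submodule. The other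
  inclusion is a Nakayama-style argument: if a maximal N misses p y, then N and p y generate M, so y
  = n + k p y with n in N. Thus N contains (1 - k p) y, and as a power of p kills y, it contains
  y.\<close>

lemma rad_primary: "rad \<Z> M = multiples p"
proof
  show "rad \<Z> M \<subseteq> multiples p"
  proof
    fix x assume x: "x \<in> rad \<Z> M"
    then have "x \<in> carrier M" by (simp add: rad_def)
    show "x \<in> multiples p"
    proof (rule ccontr)
      assume "x \<notin> multiples p"
      then obtain C where "maximal_submodule C \<Z> M" "x \<notin> C"
        using maximal_submodule_avoiding[OF prime_p \<open>x \<in> carrier M\<close>] by blast
      then show False using x by (auto simp: rad_def)
    qed
  qed
  have "p \<odot> y \<in> N" if y: "y \<in> carrier M" and N: "maximal_submodule N \<Z> M" for y N
  proof (rule ccontr)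
    assume "p \<odot> y \<notin> N"
    have sN: "submodule N \<Z> M" using N by (simp add: maximal_submodule_def)
    have py: "p \<odot> y \<in> carrier M" using y by simp
    note s = submodule_cyclic[OF py]
    have "N \<subseteq> N <+>\<^bsub>M\<^esub> cyclic (p \<odot> y)" "p \<odot> y \<in> N <+>\<^bsub>M\<^esub> cyclic (p \<odot> y)"
      using set_add_left[OF s submodule_carrier[OF sN]]
        set_add_right[OF sN submodule_carrier[OF s]] cyclic_self[OF py] by auto
    then have "N <+>\<^bsub>M\<^esub> cyclic (p \<odot> y) = carrier M"
      using N submodule_set_add[OF sN s] \<open>p \<odot> y \<notin> N\<close> unfolding maximal_submodule_def by blast
    then have "y \<in> N <+>\<^bsub>M\<^esub> cyclic (p \<odot> y)" using y by simp
    then obtain n k where nk: "n \<in> N" "y = n \<oplus> (k * p) \<odot> y"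
      using y by (auto simp: mem_set_add_iff cyclic_def mult_smult)
    have nc: "n \<in> carrier M" using submodule_carrier sN nk by blast
    have "(1 + - (k * p)) \<odot> y = y \<ominus> (k * p) \<odot> y"
      using y by (simp only: add_smult minus_smult one_smult M.minus_eq)
    also have "\<dots> = n" using nk nc y
      by (metis M.add.inv_solve_right M.minus_eq smult_carrier)
    finally have "(1 + - (k * p)) \<odot> y \<in> N" using nk by simp
    moreover obtain m where "p ^ m \<odot> y = \<zero>" using primary y by blast
    moreover have "coprime (1 + - (k * p)) (p ^ m)"
    proof -
      have "coprime (1 + - (k * p)) p"
        by (rule coprimeI) (metis dvd_add_right_iff dvd_minus_iff dvd_mult add.commute)
      then show ?thesis by simp
    qed
    ultimately have "y \<in> N"
      using coprime_smult_mem[OF sN y] submodule_zero[OF sN] by metis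
    then show False using \<open>p \<odot> y \<notin> N\<close> submodule_smult[OF sN] by blast
  qed
  then show "multiples p \<subseteq> rad \<Z> M" by (auto simp: rad_def multiples_def)
qed

text \<open>Take the last nonzero term of the sequence x, p x, p^2 x and so on.\<close>

lemma smult_power_socle_at:
  assumes "x \<in> carrier M" "x \<noteq> \<zero>"
  obtains n where "p ^ n \<odot> x \<in> socle_at p" "p ^ n \<odot> x \<noteq> \<zero>"
proof -
  obtain n where n: "p ^ n \<odot> x = \<zero>" and least: "\<And>m. m < n \<Longrightarrow> p ^ m \<odot> x \<noteq> \<zero>"
    using primary[OF assms(1)] exists_least_iff[of "\<lambda>n. p ^ n \<odot> x = \<zero>"] by blast
  then obtain m where "n = Suc m" using assms by (cases n) auto
  then show ?thesis
    using that[of m] n least[of m] assms by (simp add: socle_at_def mult_smult)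
qed

text \<open>Semisimplicity means that p kills M. If some p y were nonzero, its last nonzero multiple
  by a power of p would be a nonzero socle element that is a multiple of p.\<close>

lemma semisimple_primary_iff: "semisimple \<Z> M \<longleftrightarrow> socle_at p \<inter> multiples p \<subseteq> {\<zero>}"
  unfolding semisimple_def soc_primary
proof
  assume "socle_at p = carrier M"
  then show "socle_at p \<inter> multiples p \<subseteq> {\<zero>}" by (auto simp: socle_at_def multiples_def)
next
  assume triv: "socle_at p \<inter> multiples p \<subseteq> {\<zero>}"
  have "p \<odot> y = \<zero>" if y: "y \<in> carrier M" for y
  proof (rule ccontr)
    assume "p \<odot> y \<noteq> \<zero>"
    then obtain n where n: "p ^ n \<odot> (p \<odot> y) \<in> socle_at p" "p ^ n \<odot> (p \<odot> y) \<noteq> \<zero>"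
      using smult_power_socle_at[of "p \<odot> y"] y by blast
    moreover have "p ^ n \<odot> (p \<odot> y) \<in> multiples p"
      using submodule_smult[OF submodule_multiples] y by (auto simp: multiples_def)
    ultimately show False using triv by blast
  qed
  then show "socle_at p = carrier M" by (auto simp: socle_at_def)
qed

end

section \<open>Torsion and primary components\<close>

context abelian_group
begin

lemma Z_module_int_module: "Z_module (int_module G)"
  using module_int_module by (simp add: Z_module_def)

lemma smult_int_module: "int n \<odot>\<^bsub>int_module G\<^esub> x = [n] \<cdot> x"
  by (simp add: int_module_def add_pow_def int_pow_int)

lemma Z_module_torsion_module: "Z_module (torsion_module G)"
  unfolding torsion_module_def
  by (rule Z_module.Z_module_submodule[OF Z_module_int_module submodule_torsion])

lemma primary_Z_module_primary_module:
  assumes "prime p"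
  shows "primary_Z_module (primary_module p G) (int p)"
proof -
  interpret P: Z_module "primary_module p G"
    unfolding primary_module_def
    by (rule Z_module.Z_module_submodule[OF Z_module_int_module submodule_primary_component])
  show ?thesis
  proof
    show "prime (int p)" using assms by simp
    fix x assume "x \<in> carrier (primary_module p G)"
    then obtain n where "[(p ^ n)] \<cdot> x = \<zero>"
      by (auto simp: primary_module_def primary_component_def)
    then show "\<exists>n. int p ^ n \<odot>\<^bsub>primary_module p G\<^esub> x = \<zero>\<^bsub>primary_module p G\<^esub>"
      using smult_int_module[of "p ^ n" x]
      by (intro exI[of _ n]) (simp add: primary_module_def int_module_def)
  qed
qed

text \<open>Supplies the hypothesis of \<open>socle_dichotomy_submodule\<close> for the primary
  component and, since that lies inside the torsion subgroup, for the latter too.\<close>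

lemma primary_componentI:
  assumes "prime p" "x \<in> carrier G" "[(p * p)] \<cdot> x = \<zero>"
  shows "x \<in> primary_component p G"
proof -
  have "x \<in> torsion G"
    using assms prime_gt_0_nat[of p] by (auto simp: torsion_def intro!: exI[of _ "p * p"])
  moreover have "[(p ^ 2)] \<cdot> x = \<zero>" using assms by (simp add: power2_eq_square)
  ultimately show ?thesis
    unfolding primary_component_def by (auto intro!: exI[of _ 2])
qed

lemma socle_dichotomy_torsion_module:
  assumes "prime p"
  shows "Z_module.socle_dichotomy (torsion_module G) (int p) \<longleftrightarrow>
    Z_module.socle_dichotomy (int_module G) (int p)"
  unfolding torsion_module_def
proof (rule Z_module.socle_dichotomy_submodule[OF Z_module_int_module submodule_torsion])
  fix x assume "x \<in> carrier (int_module G)" "(int p * int p) \<odot>\<^bsub>int_module G\<^esub> x = \<zero>\<^bsub>int_module G\<^esub>"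
  then show "x \<in> torsion G"
    using primary_componentI[OF assms, of x] smult_int_module[of "p * p" x]
    by (simp add: int_module_def primary_component_def)
qed

lemma socle_dichotomy_primary_module:
  assumes "prime p"
  shows "Z_module.socle_dichotomy (primary_module p G) (int p) \<longleftrightarrow>
    Z_module.socle_dichotomy (int_module G) (int p)"
  unfolding primary_module_def
proof (rule Z_module.socle_dichotomy_submodule[OF Z_module_int_module submodule_primary_component])
  fix x assume "x \<in> carrier (int_module G)" "(int p * int p) \<odot>\<^bsub>int_module G\<^esub> x = \<zero>\<^bsub>int_module G\<^esub>"
  then show "x \<in> primary_component p G"
    using primary_componentI[OF assms, of x] smult_int_module[of "p * p" x]
    by (simp add: int_module_def)
qed

end

theorem theorem2:
  fixes M :: "('a, 'b) ring_scheme"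
  assumes "abelian_group M"
  shows "(simple_direct_injective \<Z> (int_module M)
            \<longleftrightarrow> simple_direct_injective \<Z> (torsion_module M)) \<and>
         (simple_direct_injective \<Z> (torsion_module M)
            \<longleftrightarrow> (\<forall>p::nat. prime p \<longrightarrow> simple_direct_injective \<Z> (primary_module p M))) \<and>
         ((\<forall>p::nat. prime p \<longrightarrow> simple_direct_injective \<Z> (primary_module p M))
            \<longleftrightarrow> (\<forall>p::nat. prime p \<longrightarrow>
                   semisimple \<Z> (primary_module p M) \<or>
                   soc \<Z> (primary_module p M) \<subseteq> rad \<Z> (primary_module p M)))"
proof -
  interpret abelian_group M by (rule assms)
  \<comment> \<open>The pivot: all four conditions are reduced to \<open>?Q p\<close> for every
    prime p.\<close>
  let ?Q = "\<lambda>p::nat. Z_module.socle_dichotomy (int_module M) (int p)"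
  \<comment> \<open>Scalars are integers while the theorem quantifies over natural primes; integer
    primes are positive by convention, so the two ranges match.\<close>
  have nat_prime: "(\<forall>p::int. prime p \<longrightarrow> P p) \<longleftrightarrow> (\<forall>p::nat. prime p \<longrightarrow> P (int p))" for P
    by (metis prime_ge_0_int nat_0_le prime_nat_int_transfer)
  have 1: "simple_direct_injective \<Z> (int_module M) \<longleftrightarrow> (\<forall>p::nat. prime p \<longrightarrow> ?Q p)"
    unfolding Z_module.simple_direct_injective_iff[OF Z_module_int_module] nat_prime ..
  have 2: "simple_direct_injective \<Z> (torsion_module M) \<longleftrightarrow> (\<forall>p::nat. prime p \<longrightarrow> ?Q p)"
    unfolding Z_module.simple_direct_injective_iff[OF Z_module_torsion_module] nat_prime
    using socle_dichotomy_torsion_module by blast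
  have 3: "simple_direct_injective \<Z> (primary_module p M) \<longleftrightarrow> ?Q p"
    and 4: "semisimple \<Z> (primary_module p M) \<or>
      soc \<Z> (primary_module p M) \<subseteq> rad \<Z> (primary_module p M) \<longleftrightarrow> ?Q p" if "prime p" for p
  proof -
    interpret P: primary_Z_module "primary_module p M" "int p"
      by (rule primary_Z_module_primary_module[OF that])
    show "simple_direct_injective \<Z> (primary_module p M) \<longleftrightarrow> ?Q p"
      using P.simple_direct_injective_primary socle_dichotomy_primary_module[OF that] by blast
    show "semisimple \<Z> (primary_module p M) \<or>
      soc \<Z> (primary_module p M) \<subseteq> rad \<Z> (primary_module p M) \<longleftrightarrow> ?Q p"
      \<comment> \<open>With socle, radical and semisimplicity computed, condition (4) at p is
        literally the dichotomy.\<close>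
      unfolding socle_dichotomy_primary_module[OF that, symmetric] P.socle_dichotomy_def
        P.semisimple_primary_iff P.soc_primary P.rad_primary ..
  qed
  show ?thesis unfolding 1 2 using 3 4 by blast
qed

end
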